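(* Let $A = \{a_1, \dots, a_N\}$ be a multiset of $N$ positive integers and let $k$ be a positive integer. If $\sum A \leq 2N - 2$, $\sum A - N + 1 \leq k \leq N$, and $a \leq k$ for every $a \in A$, then there exists a sub-multiset $B \subseteq A$ with $\sum B = k$, and such a $B$ can be found in $O(N)$ time.
   Context: For a multiset $B$ of integers, $\sum B := \sum_{a \in B} a$. Running times assume constant-time arithmetic operations. *)

theory Defs
  imports Complex_Main "HOL-Library.Multiset" "HOL-Library.Landau_Symbols"
begin

text \<open>
  Running times are step counts on the random access machine of Cook and Reckhow (1973) under the
  uniform cost criterion: each executed instruction, in particular each addition or subtraction of
  integers, costs one step. Registers are indexed by natural numbers, hold integers and are
  initially zero; the input is read from, and the output written to, a sequence of integers.
\<close>

datatype instr =
    Const nat int      \<comment> \<open>\<open>X\<^sub>i := c\<close>\<close>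
  | Add nat nat nat    \<comment> \<open>\<open>X\<^sub>i := X\<^sub>j + X\<^sub>l\<close>\<close>
  | Sub nat nat nat    \<comment> \<open>\<open>X\<^sub>i := X\<^sub>j - X\<^sub>l\<close>\<close>
  | Load nat nat       \<comment> \<open>\<open>X\<^sub>i := X\<^bsub>X\<^sub>j\<^esub>\<close>\<close>
  | Store nat nat      \<comment> \<open>\<open>X\<^bsub>X\<^sub>i\<^esub> := X\<^sub>j\<close>\<close>
  | JumpPos nat nat    \<comment> \<open>continue at instruction \<open>p\<close> if \<open>X\<^sub>j > 0\<close>\<close>
  | Read nat
  | Print nat

type_synonym program = "instr list"

datatype config =
  Config (pc: nat) (regs: "nat \<Rightarrow> int") (inp: "int list") (outp: "int list")

text \<open>
  The value \<^term>\<open>None\<close> means that the machine is stuck: it addresses a register with a negative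
  index or reads past the end of the input. Being stuck does not count as halting.
\<close>

fun exec :: "instr \<Rightarrow> config \<Rightarrow> config option" where
  "exec (Const i c) (Config p X xs ys) = Some (Config (p + 1) (X(i := c)) xs ys)"
| "exec (Add i j l) (Config p X xs ys) = Some (Config (p + 1) (X(i := X j + X l)) xs ys)"
| "exec (Sub i j l) (Config p X xs ys) = Some (Config (p + 1) (X(i := X j - X l)) xs ys)"
| "exec (Load i j) (Config p X xs ys) =
     (if X j \<ge> 0 then Some (Config (p + 1) (X(i := X (nat (X j)))) xs ys) else None)"
| "exec (Store i j) (Config p X xs ys) =
     (if X i \<ge> 0 then Some (Config (p + 1) (X(nat (X i) := X j)) xs ys) else None)"
| "exec (JumpPos j q) (Config p X xs ys) =
     Some (Config (if X j > 0 then q else p + 1) X xs ys)"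
| "exec (Read i) (Config p X xs ys) =
     (case xs of [] \<Rightarrow> None | x # xs' \<Rightarrow> Some (Config (p + 1) (X(i := x)) xs' ys))"
| "exec (Print i) (Config p X xs ys) = Some (Config (p + 1) X xs (ys @ [X i]))"

definition halted :: "program \<Rightarrow> config \<Rightarrow> bool" where
  "halted P c \<longleftrightarrow> pc c \<ge> length P"

definition step :: "program \<Rightarrow> config \<Rightarrow> config option" where
  "step P c = (if halted P c then None else exec (P ! pc c) c)"

fun run :: "program \<Rightarrow> nat \<Rightarrow> config \<Rightarrow> config option" where
  "run P 0 c = Some c"
| "run P (Suc t) c = Option.bind (step P c) (run P t)"

definition init :: "int list \<Rightarrow> config" where
  "init xs = Config 0 (\<lambda>_. 0) xs []"

text \<open>
  Since a halted configuration has no successor, \<open>t\<close> below is the exact running time, and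
  both \<open>t\<close> and the output \<open>ys\<close> are determined by the program and the input \<open>xs\<close>.
\<close>

definition computes_in :: "program \<Rightarrow> int list \<Rightarrow> int list \<Rightarrow> nat \<Rightarrow> bool" where
  "computes_in P xs ys t \<longleftrightarrow> (\<exists>c. run P t (init xs) = Some c \<and> halted P c \<and> outp c = ys)"

end

theory Submission
  imports Defs
begin

text \<open>
  Scan the input once and take every element greater than 1 that still fits into the remaining
  target, then fill the remaining target \<open>r\<close> with ones. Let \<open>m\<close> be the number of ones. If every
  element greater than 1 was taken, then \<open>r = k - (\<Sum>A - m) \<le> m\<close> as \<open>k \<le> N \<le> \<Sum>A\<close>. If some \<open>b\<close> was
  rejected, then \<open>r < b\<close>, and \<open>b \<le> m\<close> follows from \<open>\<Sum>A \<le> 2 * N - 2\<close> because all elements other than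
  \<open>b\<close> and the ones are at least 2.
\<close>

fun greedy :: "int \<Rightarrow> int list \<Rightarrow> int list" where
  "greedy r [] = []"
| "greedy r (a # as) = (if 1 < a \<and> a \<le> r then a # greedy (r - a) as else greedy r as)"

lemma mset_greedy: "mset (greedy r as) \<subseteq># filter_mset (\<lambda>a. 1 < a) (mset as)"
  by (induction r as rule: greedy.induct) (auto intro: subset_mset.order_trans)

lemma sum_list_greedy_le: "0 \<le> r \<Longrightarrow> sum_list (greedy r as) \<le> r"
proof (induction r as rule: greedy.induct)
  case (2 r a as)
  then show ?case by (cases "1 < a \<and> a \<le> r") force+
qed simp

text \<open>The remaining target never increases during the scan, so an element once rejected for
  exceeding it also exceeds the final remainder.\<close>

lemma greedy_cases:
  assumes "0 \<le> r"
  shows "greedy r as = filter (\<lambda>a. 1 < a) as \<or> (\<exists>b\<in>set as. r - sum_list (greedy r as) < b)"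
  using assms
proof (induction r as rule: greedy.induct)
  case (2 r a as)
  show ?case
  proof (cases "1 < a \<and> a \<le> r")
    case True
    with 2 show ?thesis by (auto simp: algebra_simps)
  next
    case False
    \<comment> \<open>If \<open>r < a\<close>, this makes \<open>a\<close> itself the witness: the
      remainder is at most \<open>r\<close>.\<close>
    have "0 \<le> sum_list (greedy r as)"
      using mset_subset_eqD[OF mset_greedy[of r as]] by (intro sum_list_nonneg) force
    with 2 False show ?thesis by (auto simp: not_le)
  qed
qed simp

lemma sum_list_filter_gt_1:
  fixes as :: "int list"
  assumes "\<forall>a\<in>set as. 0 < a"
  shows "sum_list (filter (\<lambda>a. 1 < a) as) + int (count (mset as) 1) = sum_list as"
  using assms by (induction as) auto

lemma length_le_sum_list:
  fixes as :: "int list"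
  assumes "\<forall>a\<in>set as. 0 < a"
  shows "int (length as) \<le> sum_list as"
  using assms by (induction as) auto

text \<open>On the right every 1 counts twice, and every other element is at least 2.\<close>

lemma two_length_le:
  fixes as :: "int list"
  assumes "\<forall>a\<in>set as. 0 < a"
  shows "2 * int (length as) \<le> sum_list as + int (count (mset as) 1)"
  using assms by (induction as) auto

text \<open>The same count, except that one occurrence of \<open>b\<close> contributes
  \<open>b\<close> instead of 2. Together with the bound on the sum it yields that \<open>b\<close>
  is at most the number of ones.\<close>

lemma member_le_count_1:
  fixes as :: "int list"
  assumes "\<forall>a\<in>set as. 0 < a" and "b \<in> set as"
  shows "2 * int (length as) + b - 2 \<le> sum_list as + int (count (mset as) 1)"
  using assms
proof (induction as)
  case (Cons a as)
  show ?case
  proof (cases "b \<in> set as")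
    case True
    with Cons show ?thesis by auto
  next
    case False
    with Cons.prems two_length_le[of as] show ?thesis by auto
  qed
qed simp

lemma greedy_remainder_le_count_1:
  assumes "\<forall>a\<in>set as. 0 < a" and "sum_list as \<le> 2 * int (length as) - 2"
    and "0 \<le> k" and "k \<le> int (length as)"
  shows "k - sum_list (greedy k as) \<le> int (count (mset as) 1)"
  using greedy_cases[OF \<open>0 \<le> k\<close>, of as]
proof
  assume "greedy k as = filter (\<lambda>a. 1 < a) as"
  with sum_list_filter_gt_1[OF assms(1)] length_le_sum_list[OF assms(1)] assms(4)
  show ?thesis by simp
next
  assume "\<exists>b\<in>set as. k - sum_list (greedy k as) < b"
  with member_le_count_1[OF assms(1)] assms(2) show ?thesis by force
qed

lemma greedy_append_ones:
  assumes "\<forall>a\<in>set as. 0 < a" and "sum_list as \<le> 2 * int (length as) - 2"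
    and "0 \<le> k" and "k \<le> int (length as)"
  defines "bs \<equiv> greedy k as @ replicate (nat (k - sum_list (greedy k as))) 1"
  shows "mset bs \<subseteq># mset as" and "sum_list bs = k"
proof -
  let ?r = "nat (k - sum_list (greedy k as))"
  have "?r \<le> count (mset as) 1"
    using greedy_remainder_le_count_1[OF assms(1-4)] by simp
  \<comment> \<open>The ones come from the complement of the part that \<open>greedy\<close> draws
    from, so the two inclusions add up.\<close>
  then have "mset (replicate ?r 1) \<subseteq># filter_mset (\<lambda>a. \<not> 1 < a) (mset as)"
    by (simp add: count_le_replicate_mset_subset_eq[symmetric])
  then have "mset bs \<subseteq># filter_mset (\<lambda>a. 1 < a) (mset as) + filter_mset (\<lambda>a. \<not> 1 < a) (mset as)"
    unfolding bs_def mset_append by (intro subset_mset.add_mono mset_greedy)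
  then show "mset bs \<subseteq># mset as"
    by (simp add: multiset_partition[symmetric])
  \<comment> \<open>\<open>greedy\<close> never overshoots \<open>k\<close>, so \<open>nat\<close>
    truncates nothing.\<close>
  show "sum_list bs = k"
    using sum_list_greedy_le[OF \<open>0 \<le> k\<close>, of as] by (simp add: bs_def sum_list_replicate)
qed

text \<open>
  Register 0 counts the elements not yet read, register 1 holds the remaining target, register 2
  the current element, register 3 the constant 1, and register 4 is used for comparisons.
  As \<open>X\<^sub>3 = 1\<close>, \<open>JumpPos 3\<close> is an unconditional jump.
\<close>

definition greedy_program :: program where
  "greedy_program =
    [Read 0, Read 1, Const 3 1, JumpPos 3 13,
     Read 2, Sub 0 0 3, Sub 4 2 3, JumpPos 4 9, JumpPos 3 13,
     Sub 4 2 1, JumpPos 4 13, Print 2, Sub 1 1 2,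
     JumpPos 0 4,
     JumpPos 1 16, JumpPos 3 19, Print 3, Sub 1 1 3, JumpPos 3 14]"

lemma run_add: "run P (s + t) c = Option.bind (run P s c) (run P t)"
proof (induction s arbitrary: c)
  case (Suc s)
  then show ?case by (cases "step P c") auto
qed simp

lemmas run_simps = step_def halted_def greedy_program_def numeral_eq_Suc

text \<open>Instruction 13 is the loop test of the scan and 14 the first instruction after it. An
  iteration takes at most 9 steps; the failing last test adds 1.\<close>

lemma run_scan:
  assumes "X 0 = int (length as)" and "X 3 = 1" and "X 1 = r"
  shows "\<exists>X' t. run greedy_program t (Config 13 X as ys) = Some (Config 14 X' [] (ys @ greedy r as))
    \<and> X' 3 = 1 \<and> X' 1 = r - sum_list (greedy r as) \<and> t \<le> 9 * length as + 1"
  using assms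
proof (induction as arbitrary: X ys r)
  case Nil
  then have "run greedy_program 1 (Config 13 X [] ys) = Some (Config 14 X [] ys)"
    by (simp add: run_simps)
  with Nil show ?case by (intro exI[of _ X] exI[of _ 1]) simp
next
  case (Cons a as)
  \<comment> \<open>Target and output of one iteration, written so that all paths through the loop
    body end in the same form.\<close>
  define r' where "r' = (if 1 < a \<and> a \<le> r then r - a else r)"
  define zs where "zs = (if 1 < a \<and> a \<le> r then [a] else [])"
  have "\<exists>X' s. run greedy_program s (Config 13 X (a # as) ys) = Some (Config 13 X' as (ys @ zs))
    \<and> X' 0 = int (length as) \<and> X' 3 = 1 \<and> X' 1 = r' \<and> s \<le> 9"
  proof -
    \<comment> \<open>These are the three paths through the loop body, of 6, 7 and 9 steps. Register
      4 keeps the result of the last comparison.\<close>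
    consider "a \<le> 1" | "1 < a" "r < a" | "1 < a" "a \<le> r" by linarith
    then show ?thesis
    proof cases
      case 1
      with Cons.prems show ?thesis
        by (intro exI[of _ "X(2 := a, 0 := int (length as), 4 := a - 1)"] exI[of _ 6])
          (auto simp: run_simps r'_def zs_def)
    next
      case 2
      with Cons.prems show ?thesis
        by (intro exI[of _ "X(2 := a, 0 := int (length as), 4 := a - r)"] exI[of _ 7])
          (auto simp: run_simps r'_def zs_def)
    next
      case 3
      with Cons.prems show ?thesis
        by (intro exI[of _ "X(2 := a, 0 := int (length as), 4 := a - r, 1 := r - a)"] exI[of _ 9])
          (auto simp: run_simps r'_def zs_def)
    qed
  qed
  then obtain X' s where 1: "run greedy_program s (Config 13 X (a # as) ys) = Some (Config 13 X' as (ys @ zs))"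
    and X': "X' 0 = int (length as)" "X' 3 = 1" "X' 1 = r'" and s: "s \<le> 9" by blast
  from Cons.IH[OF X', of "ys @ zs"] obtain X'' t where
    2: "run greedy_program t (Config 13 X' as (ys @ zs)) =
      Some (Config 14 X'' [] ((ys @ zs) @ greedy r' as))"
    and X'': "X'' 3 = 1" "X'' 1 = r' - sum_list (greedy r' as)" and t: "t \<le> 9 * length as + 1"
    by blast
  have "run greedy_program (s + t) (Config 13 X (a # as) ys) =
      Some (Config 14 X'' [] (ys @ greedy r (a # as)))"
    using 1 2 by (auto simp: run_add r'_def zs_def)
  moreover have "X'' 1 = r - sum_list (greedy r (a # as))"
    using X'' by (auto simp: r'_def)
  ultimately show ?case
    using X'' s t by (intro exI[of _ X''] exI[of _ "s + t"]) auto
qed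

text \<open>Test, print, decrement and jump back make 4 steps per one; the failing test and the exit
  jump make the last 2. Address 19 lies just past the program, so the machine has halted.\<close>

lemma run_fill:
  assumes "X 3 = 1" and "X 1 = int n"
  shows "\<exists>X'. run greedy_program (4 * n + 2) (Config 14 X xs ys) =
    Some (Config 19 X' xs (ys @ replicate n 1))"
  using assms
proof (induction n arbitrary: X ys)
  case 0
  then show ?case by (simp add: run_simps)
next
  case (Suc n)
  have "run greedy_program 4 (Config 14 X xs ys) = Some (Config 14 (X(1 := int n)) xs (ys @ [1]))"
    using Suc.prems by (auto simp: run_simps)
  moreover obtain X' where "run greedy_program (4 * n + 2) (Config 14 (X(1 := int n)) xs (ys @ [1])) =
      Some (Config 19 X' xs ((ys @ [1]) @ replicate n 1))"
    using Suc.IH[of "X(1 := int n)" "ys @ [1]"] Suc.prems(1) by (auto simp: fun_upd_def simp del: run.simps)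
  ultimately have "run greedy_program (4 + (4 * n + 2)) (Config 14 X xs ys) =
      Some (Config 19 X' xs (ys @ replicate (Suc n) 1))"
    unfolding run_add by simp
  then show ?case by (auto simp del: run.simps)
qed

text \<open>The bound adds 4 steps of initialization, \<open>9 * length as + 1\<close> for the scan
  and at most \<open>4 * length as + 2\<close> for the ones.\<close>

lemma greedy_program_computes:
  assumes "0 \<le> k" and "k \<le> int (length as)" and "\<forall>a\<in>set as. 0 < a"
  shows "\<exists>t \<le> 13 * length as + 7. computes_in greedy_program (int (length as) # k # as)
    (greedy k as @ replicate (nat (k - sum_list (greedy k as))) 1) t"
proof -
  let ?r = "k - sum_list (greedy k as)"
  define X :: "nat \<Rightarrow> int" where "X = (\<lambda>_. 0)(0 := int (length as), 1 := k, 3 := 1)"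
  have 1: "run greedy_program 4 (init (int (length as) # k # as)) = Some (Config 13 X as [])"
    by (simp add: run_simps init_def X_def)
  have "X 0 = int (length as)" "X 3 = 1" "X 1 = k" by (simp_all add: X_def)
  from run_scan[OF this, of "[]"] obtain X' s where
    2: "run greedy_program s (Config 13 X as []) = Some (Config 14 X' [] (greedy k as))"
    and X': "X' 3 = 1" "X' 1 = ?r" and s: "s \<le> 9 * length as + 1"
    by auto
  have "0 \<le> ?r" using sum_list_greedy_le[OF \<open>0 \<le> k\<close>] by simp
  then have "X' 1 = int (nat ?r)" using X' by simp
  from run_fill[OF X'(1) this] obtain X'' where
    3: "run greedy_program (4 * nat ?r + 2) (Config 14 X' [] (greedy k as)) =
      Some (Config 19 X'' [] (greedy k as @ replicate (nat ?r) 1))"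
    by blast
  have "0 \<le> sum_list (greedy k as)"
    using mset_subset_eqD[OF mset_greedy[of k as]] by (intro sum_list_nonneg) force
  then have "nat ?r \<le> length as" using assms(2) by linarith
  moreover have "computes_in greedy_program (int (length as) # k # as)
    (greedy k as @ replicate (nat ?r) 1) (4 + (s + (4 * nat ?r + 2)))"
  proof -
    have "run greedy_program (4 + (s + (4 * nat ?r + 2))) (init (int (length as) # k # as)) =
        Some (Config 19 X'' [] (greedy k as @ replicate (nat ?r) 1))"
      \<comment> \<open>The instances split the run exactly where the two loops are entered.\<close>
      unfolding run_add[of _ 4] run_add[of _ s] 1 bind.bind_lunit 2 3 ..
    then show ?thesis by (auto simp: computes_in_def halted_def greedy_program_def)
  qed
  ultimately show ?thesis using s
    by (intro exI[of _ "4 + (s + (4 * nat ?r + 2))"]) auto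
qed

theorem theorem11:
  "\<exists>(P :: program) (T :: nat \<Rightarrow> nat).
     (\<lambda>N. real (T N)) \<in> O(\<lambda>N. real N) \<and>
     (\<forall>(A :: int multiset) (N :: nat) (k :: int).
        size A = N \<and> (\<forall>a \<in># A. a > 0) \<and> k > 0 \<and>
        \<Sum>\<^sub># A \<le> 2 * int N - 2 \<and>
        \<Sum>\<^sub># A - int N + 1 \<le> k \<and> k \<le> int N \<and>
        (\<forall>a \<in># A. a \<le> k) \<longrightarrow>
        (\<exists>B. B \<subseteq># A \<and> \<Sum>\<^sub># B = k) \<and>
        (\<forall>as. mset as = A \<longrightarrow>
           (\<exists>bs t. computes_in P (int N # k # as) bs t \<and> t \<le> T N \<and>
                   mset bs \<subseteq># A \<and> \<Sum>\<^sub># (mset bs) = k)))"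
proof (rule exI[of _ greedy_program], rule exI[of _ "\<lambda>N. 13 * N + 7"], intro conjI allI impI)
  show "(\<lambda>N. real (13 * N + 7)) \<in> O(\<lambda>N. real N)"
    \<comment> \<open>For \<open>N \<ge> 1\<close>, \<open>13 * N + 7 \<le> 20 * N\<close>.\<close>
    by (intro bigoI[of _ 20] eventually_sequentiallyI[of 1]) simp
next
  fix A :: "int multiset" and N :: nat and k :: int
  assume "size A = N \<and> (\<forall>a \<in># A. a > 0) \<and> k > 0 \<and>
        \<Sum>\<^sub># A \<le> 2 * int N - 2 \<and>
        \<Sum>\<^sub># A - int N + 1 \<le> k \<and> k \<le> int N \<and>
        (\<forall>a \<in># A. a \<le> k)"
  then have *: "\<forall>a\<in>set as. 0 < a" "sum_list as \<le> 2 * int (length as) - 2"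
    "0 \<le> k" "k \<le> int (length as)" "N = length as" if "mset as = A" for as
    using that by (auto simp flip: sum_mset_sum_list)
  have computes: "\<exists>bs t. computes_in greedy_program (int N # k # as) bs t \<and> t \<le> 13 * N + 7 \<and>
      mset bs \<subseteq># A \<and> \<Sum>\<^sub># (mset bs) = k" if "mset as = A" for as
    using greedy_append_ones[OF *(1-4)[OF that]] greedy_program_computes[OF *(3,4,1)[OF that]]
      *(5)[OF that] that by (auto simp: sum_mset_sum_list simp del: mset_append sum_list_append)
  \<comment> \<open>Existence of \<open>B\<close> follows from the output of the program on any
    enumeration of \<open>A\<close>.\<close>
  obtain as where "mset as = A" using ex_mset by blast
  from computes[OF this] show "\<exists>B. B \<subseteq># A \<and> \<Sum>\<^sub># B = k" by blast
  fix as assume "mset as = A"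
  from computes[OF this] show "\<exists>bs t. computes_in greedy_program (int N # k # as) bs t \<and>
      t \<le> 13 * N + 7 \<and> mset bs \<subseteq># A \<and> \<Sum>\<^sub># (mset bs) = k" .
qed

end
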